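(* Let $G$ be a finite connected graph that contains neither $2P_2$ (the disjoint union of two copies of the single-edge path $P_2$) nor $\overline{P_5}$ (the complement of the path on $5$ vertices, the "house") as an induced subgraph. Then $c(G) \leq 2$.
   Context: Cops and Robber game on a finite connected graph $G$: a player controlling $k$ cops places them on vertices (not necessarily distinct), then the robber is placed on a vertex; then the cops and the robber alternately move, each piece in its turn either moving to an adjacent vertex or staying put. The cops win if after finitely many rounds some cop occupies the same vertex as the robber; both sides have complete information. The cop number $c(G)$ is the minimum number of cops that can guarantee capture of the robber on $G$. *)

theory Defs
  imports
    "Graph_Theory.Pair_Digraph"
    "Graph_Theory.Digraph_Component"
    "Graph_Theory.Digraph_Isomorphism"
begin

text \<open>
  Simple undirected graphs are symmetric digraphs, as in the library locale \<^locale>\<open>graph\<close>;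
  the library notion \<^const>\<open>connected\<close> includes having at least one vertex.
\<close>

definition path_graph :: "nat \<Rightarrow> nat pair_pre_digraph" where
  "path_graph n =
    \<lparr> pverts = {..<n}, parcs = {(i, j). i < n \<and> j < n \<and> (j = Suc i \<or> i = Suc j)} \<rparr>"

definition complement_graph :: "'a pair_pre_digraph \<Rightarrow> 'a pair_pre_digraph" where
  "complement_graph H =
    \<lparr> pverts = pverts H,
      parcs = {(u, v). u \<in> pverts H \<and> v \<in> pverts H \<and> u \<noteq> v \<and> (u, v) \<notin> parcs H} \<rparr>"

definition disjoint_union_graph ::
    "'a pair_pre_digraph \<Rightarrow> 'b pair_pre_digraph \<Rightarrow> ('a + 'b) pair_pre_digraph" where
  "disjoint_union_graph H K =
    \<lparr> pverts = pverts H <+> pverts K,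
      parcs = map_prod Inl Inl ` parcs H \<union> map_prod Inr Inr ` parcs K \<rparr>"

definition two_P2 :: "(nat + nat) pair_pre_digraph" where
  "two_P2 = disjoint_union_graph (path_graph 2) (path_graph 2)"

definition house :: "nat pair_pre_digraph" where
  "house = complement_graph (path_graph 5)"

definition contains_induced :: "('a, 'b) pre_digraph \<Rightarrow> 'c pair_pre_digraph \<Rightarrow> bool" where
  "contains_induced G H \<longleftrightarrow>
    (\<exists>H'. induced_subgraph H' G \<and> digraph_iso (with_proj H) H')"

text \<open>
  A play of the game on \<open>G\<close> is described by sequences \<open>c\<close> and \<open>r\<close>: the list \<open>c t\<close> contains the
  positions of the cops, and \<open>r t\<close> is the position of the robber, after \<open>t\<close> moves of the
  respective side. The chronological order is \<open>c 0, r 0, c 1, r 1, \<dots>\<close>. Plays are infinite; what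
  happens after a capture is irrelevant, since staying put is always allowed.
\<close>

definition game_step :: "('a, 'b) pre_digraph \<Rightarrow> 'a \<Rightarrow> 'a \<Rightarrow> bool" where
  "game_step G u v \<longleftrightarrow> v = u \<or> u \<rightarrow>\<^bsub>G\<^esub> v"

definition legal_cops :: "('a, 'b) pre_digraph \<Rightarrow> nat \<Rightarrow> (nat \<Rightarrow> 'a list) \<Rightarrow> bool" where
  "legal_cops G k c \<longleftrightarrow>
    length (c 0) = k \<and> set (c 0) \<subseteq> verts G \<and> (\<forall>t. list_all2 (game_step G) (c t) (c (Suc t)))"

definition legal_robber :: "('a, 'b) pre_digraph \<Rightarrow> (nat \<Rightarrow> 'a) \<Rightarrow> bool" where
  "legal_robber G r \<longleftrightarrow> r 0 \<in> verts G \<and> (\<forall>t. game_step G (r t) (r (Suc t)))"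

text \<open>
  The robber may be caught by its own placement or move (first disjunct), or by a move of the
  cops (second disjunct).
\<close>

definition captured :: "(nat \<Rightarrow> 'a list) \<Rightarrow> (nat \<Rightarrow> 'a) \<Rightarrow> bool" where
  "captured c r \<longleftrightarrow> (\<exists>t. r t \<in> set (c t) \<or> r t \<in> set (c (Suc t)))"

text \<open>
  A strategy of the cops consists of an initial placement \<open>p\<close> and a function \<open>s\<close> that determines
  the next positions of the cops from the whole history of the play.
\<close>

definition follows_strategy ::
    "'a list \<Rightarrow> ('a list list \<Rightarrow> 'a list \<Rightarrow> 'a list) \<Rightarrow> (nat \<Rightarrow> 'a list) \<Rightarrow> (nat \<Rightarrow> 'a) \<Rightarrow> bool" where
  "follows_strategy p s c r \<longleftrightarrow>
    c 0 = p \<and> (\<forall>t. c (Suc t) = s (map c [0..<Suc t]) (map r [0..<Suc t]))"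

definition cops_win :: "('a, 'b) pre_digraph \<Rightarrow> nat \<Rightarrow> bool" where
  "cops_win G k \<longleftrightarrow>
    (\<exists>p s. \<forall>c r. legal_robber G r \<and> follows_strategy p s c r \<longrightarrow>
      legal_cops G k c \<and> captured c r)"

definition cop_number :: "('a, 'b) pre_digraph \<Rightarrow> nat" where
  "cop_number G = (LEAST k. cops_win G k)"

text \<open>On finite graphs the minimum is attained, as one cop per vertex suffices.\<close>

lemma cops_win_card_verts:
  assumes "finite (verts G)"
  shows "cops_win G (card (verts G))"
proof -
  obtain p where p: "set p = verts G" "length p = card (verts G)"
    using assms finite_distinct_list distinct_card by metis
  have "legal_cops G (card (verts G)) c \<and> captured c r"
    if r: "legal_robber G r" and c: "follows_strategy p (\<lambda>cs rs. last cs) c r" for c r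
  proof -
    have "c (Suc t) = c t" for t
      using c by (simp add: follows_strategy_def)
    moreover have "c 0 = p"
      using c by (simp add: follows_strategy_def)
    moreover have "r 0 \<in> verts G"
      using r by (simp add: legal_robber_def)
    ultimately show ?thesis
      using p by (auto simp: legal_cops_def captured_def game_step_def list_all2_same)
  qed
  then show ?thesis
    unfolding cops_win_def by blast
qed

lemma cops_win_cop_number:
  assumes "finite (verts G)"
  shows "cops_win G (cop_number G)"
  unfolding cop_number_def using cops_win_card_verts[OF assms] by (rule LeastI)

end

theory Submission
  imports Defs
begin

text \<open>
  Suppose a vertex \<open>p\<close> satisfies \<open>r \<in> N[p]\<close> or \<open>N(r) \<subseteq> N[p]\<close>. A cop waiting at \<open>p\<close> then catches the
  robber as soon as he leaves \<open>r\<close>, while a second cop walks to \<open>r\<close>. So two cops win if there are \<open>p\<close> and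
  \<open>q\<close> such that every vertex is guarded in this sense by \<open>p\<close> or by \<open>q\<close>. If the ends of some edge
  \<open>a b\<close> do not have this property, an unguarded vertex \<open>r\<close> completes \<open>a\<close>, \<open>b\<close> to an induced
  5-cycle, because the only other possibility is a house. With respect to an induced 5-cycle every vertex
  is complete, anticomplete, or a twin of one of the five vertices, and every neighbour of an
  anticomplete vertex is complete. If there is a complete vertex, it guards all vertices jointly with
  any vertex of the cycle; otherwise all vertices are twins, and two nonadjacent vertices of the cycle suffice.
\<close>

section \<open>Guards and neighbourhoods with respect to an induced 5-cycle\<close>

definition guards :: "('a \<Rightarrow> 'a \<Rightarrow> bool) \<Rightarrow> 'a \<Rightarrow> 'a \<Rightarrow> bool" where
  "guards E p r \<longleftrightarrow> E\<^sup>=\<^sup>= p r \<or> (\<forall>v. E r v \<longrightarrow> E\<^sup>=\<^sup>= p v)"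

text \<open>In both exclusions the vertices may coincide: every coincidence compatible with
  \<open>irrefl\<close> already makes one of the alternatives true. In \<open>house_free\<close> the
  4-cycle \<open>a b y x\<close> carries the roof \<open>r\<close> over the edge
  \<open>x y\<close>.\<close>

locale two_P2_house_free =
  fixes E :: "'a \<Rightarrow> 'a \<Rightarrow> bool"
  assumes sym: "E x y \<Longrightarrow> E y x"
    and irrefl: "\<not> E x x"
    and two_P2_free: "E w x \<Longrightarrow> E y z \<Longrightarrow> E w y \<or> E w z \<or> E x y \<or> E x z"
    and house_free: "E a b \<Longrightarrow> E b y \<Longrightarrow> E y x \<Longrightarrow> E x a \<Longrightarrow> E r x \<Longrightarrow> E r y \<Longrightarrow>
      E a y \<or> E b x \<or> E r a \<or> E r b"
begin

definition induced_C5 :: "'a \<Rightarrow> 'a \<Rightarrow> 'a \<Rightarrow> 'a \<Rightarrow> 'a \<Rightarrow> bool" where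
  "induced_C5 a b c d e \<longleftrightarrow> E a b \<and> E b c \<and> E c d \<and> E d e \<and> E e a \<and>
    \<not> E a c \<and> \<not> E b d \<and> \<not> E c e \<and> \<not> E d a \<and> \<not> E e b"

lemma induced_C5_rotate: "induced_C5 a b c d e \<Longrightarrow> induced_C5 b c d e a"
  unfolding induced_C5_def by blast

lemma induced_C5_reflect: "induced_C5 a b c d e \<Longrightarrow> induced_C5 a e d c b"
  unfolding induced_C5_def using sym by blast

text \<open>Otherwise the edges \<open>v a\<close> and \<open>c d\<close> induce a 2P2, because
  \<open>a\<close> is adjacent to neither \<open>c\<close> nor \<open>d\<close>.\<close>

lemma induced_C5_opposite:
  assumes "induced_C5 a b c d e" "E v a"
  shows "E v c \<or> E v d"
  using assms two_P2_free[of v a c d] sym unfolding induced_C5_def by blast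

text \<open>Otherwise the 4-cycle \<open>a e v b\<close> with the roof \<open>c\<close> over
  \<open>v b\<close> is a house.\<close>

lemma induced_C5_fill:
  assumes "induced_C5 a b c d e" "E v b" "E v c" "E v e"
  shows "E v a"
  using assms house_free[of a e v b c] sym irrefl unfolding induced_C5_def by blast

text \<open>By \<open>induced_C5_opposite\<close>, a nonempty neighbourhood contains two nonadjacent
  vertices of the cycle. Any third one spreads to all five by \<open>induced_C5_opposite\<close> and
  both orientations of \<open>induced_C5_fill\<close>.\<close>

lemma induced_C5_neighbourhood:
  assumes C: "induced_C5 a b c d e"
  shows "E v a \<and> E v b \<and> E v c \<and> E v d \<and> E v e \<or>
    \<not> E v a \<and> \<not> E v b \<and> \<not> E v c \<and> \<not> E v d \<and> \<not> E v e \<or>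
    \<not> E v a \<and> E v b \<and> \<not> E v c \<and> \<not> E v d \<and> E v e \<or>
    E v a \<and> \<not> E v b \<and> E v c \<and> \<not> E v d \<and> \<not> E v e \<or>
    \<not> E v a \<and> E v b \<and> \<not> E v c \<and> E v d \<and> \<not> E v e \<or>
    \<not> E v a \<and> \<not> E v b \<and> E v c \<and> \<not> E v d \<and> E v e \<or>
    E v a \<and> \<not> E v b \<and> \<not> E v c \<and> E v d \<and> \<not> E v e"
proof -
  note C1 = induced_C5_rotate[OF C]
  note C2 = induced_C5_rotate[OF C1]
  note C3 = induced_C5_rotate[OF C2]
  note C4 = induced_C5_rotate[OF C3]
  note rotations = C C1 C2 C3 C4
  note facts = rotations[THEN induced_C5_opposite, of v]
    rotations[THEN induced_C5_fill, of v]
    rotations[THEN induced_C5_reflect, THEN induced_C5_fill, of v]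
  from facts show ?thesis
    by argo
qed

lemma induced_C5_replace:
  assumes "induced_C5 a b c d e" "E v b" "\<not> E v c" "\<not> E v d" "E v e"
  shows "induced_C5 v b c d e"
  using assms sym unfolding induced_C5_def by blast

text \<open>\<open>v\<close> can replace \<open>a\<close> in the cycle, and by the classification
  the adjacency of a vertex to \<open>b\<close>, \<open>c\<close>, \<open>d\<close>,
  \<open>e\<close> determines its adjacency to the fifth vertex of either cycle.\<close>

lemma induced_C5_guards_twin:
  assumes C: "induced_C5 a b c d e" and v: "E v b" "\<not> E v c" "\<not> E v d" "E v e"
  shows "guards E a v"
proof -
  have "E a w" if "E v w" for w
    using induced_C5_neighbourhood[OF C, of w]
      induced_C5_neighbourhood[OF induced_C5_replace[OF C v], of w] sym that
    by blast
  then show ?thesis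
    by (simp add: guards_def)
qed

lemma induced_C5_complete_twin:
  assumes C: "induced_C5 a b c d e" and v: "E v b" "\<not> E v c" "\<not> E v d" "E v e"
    and w: "E w a" "E w b" "E w c" "E w d" "E w e"
  shows "E w v"
  using induced_C5_neighbourhood[OF induced_C5_replace[OF C v], of w] w by blast

text \<open>By 2P2-freeness \<open>w\<close> is adjacent to an end of every cycle edge. Covering all
  five edges takes three vertices, which leaves only the complete pattern.\<close>

lemma induced_C5_anticomplete_neighbour:
  assumes C: "induced_C5 a b c d e"
    and v: "\<not> E v a" "\<not> E v b" "\<not> E v c" "\<not> E v d" "\<not> E v e"
    and w: "E v w"
  shows "E w a \<and> E w b \<and> E w c \<and> E w d \<and> E w e"
proof -
  have edges: "E a b" "E b c" "E c d" "E d e" "E e a"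
    using C by (simp_all add: induced_C5_def)
  show ?thesis
    using induced_C5_neighbourhood[OF C, of w] edges[THEN two_P2_free[OF w]] v by argo
qed

text \<open>The locale knows only adjacency; the existence of a neighbour later places
  \<open>p\<close> and \<open>q\<close> in the vertex set of the graph.\<close>

lemma induced_C5_guards:
  assumes C: "induced_C5 a b c d e" and V: "\<And>x. x \<in> V \<Longrightarrow> \<exists>y. E x y"
  shows "\<exists>p q. (\<exists>x. E p x) \<and> (\<exists>x. E q x) \<and> (\<forall>r\<in>V. guards E p r \<or> guards E q r)"
proof -
  note C1 = induced_C5_rotate[OF C]
  note C2 = induced_C5_rotate[OF C1]
  note C3 = induced_C5_rotate[OF C2]
  note C4 = induced_C5_rotate[OF C3]
  show ?thesis
  proof (cases "\<exists>w. E w a \<and> E w b \<and> E w c \<and> E w d \<and> E w e")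
    case True
    then obtain w where w: "E w a" "E w b" "E w c" "E w d" "E w e"
      by blast
    \<comment> \<open>Twins are adjacent to \<open>w\<close> and complete vertices to
      \<open>a\<close>; an anticomplete vertex has only complete neighbours, all of them adjacent to
      \<open>a\<close>.\<close>
    have "guards E w r \<or> guards E a r" for r
    proof -
      consider
        "E r a" |
        "\<not> E r a" "\<not> E r b" "\<not> E r c" "\<not> E r d" "\<not> E r e" |
        "E w r"
        using induced_C5_neighbourhood[OF C, of r]
          induced_C5_complete_twin[OF C, of r w] induced_C5_complete_twin[OF C1, of r w]
          induced_C5_complete_twin[OF C2, of r w] induced_C5_complete_twin[OF C3, of r w]
          induced_C5_complete_twin[OF C4, of r w] w by argo
      then show ?thesis
      proof cases
        case 1
        then show ?thesis using sym by (auto simp: guards_def)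
      next
        case 2
        then have "E a x" if "E r x" for x
          using induced_C5_anticomplete_neighbour[OF C _ _ _ _ _ that] sym by blast
        then show ?thesis by (simp add: guards_def)
      next
        case 3
        then show ?thesis by (simp add: guards_def)
      qed
    qed
    then show ?thesis
      using C w(1) unfolding induced_C5_def by blast
  next
    case False
    have "guards E a r \<or> guards E d r" if "r \<in> V" for r
    proof -
      obtain x where "E r x"
        using V \<open>r \<in> V\<close> by blast
      \<comment> \<open>The neighbour \<open>x\<close> of an anticomplete \<open>r\<close> would be
        complete, so \<open>r\<close> is a twin. Only the twins of \<open>a\<close> and of
        \<open>d\<close> are adjacent to neither \<open>a\<close> nor \<open>d\<close>.\<close>
      then consider "E r a" | "E r d" |
        "E r b" "\<not> E r c" "\<not> E r d" "E r e" |
        "E r e" "\<not> E r a" "\<not> E r b" "E r c"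
        using False induced_C5_neighbourhood[OF C, of r]
          induced_C5_anticomplete_neighbour[OF C _ _ _ _ _ \<open>E r x\<close>] by blast
      then show ?thesis
        using induced_C5_guards_twin[OF C] induced_C5_guards_twin[OF C3] sym
        by cases (auto simp: guards_def)
    qed
    then show ?thesis
      using C unfolding induced_C5_def by blast
  qed
qed

text \<open>Let \<open>x\<close> and \<open>y\<close> be neighbours of \<open>r\<close> missed by
  \<open>b\<close> and by \<open>a\<close>, respectively. Comparing the edge \<open>a b\<close> with
  \<open>r x\<close> and \<open>r y\<close> forces \<open>E a x\<close> and \<open>E b y\<close>; an
  edge \<open>y x\<close> would complete a house with roof \<open>r\<close>.\<close>

lemma unguarded_induced_C5:
  assumes "E a b" "\<not> guards E a r" "\<not> guards E b r"
  obtains x y where "induced_C5 a b y r x"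
proof -
  from assms obtain x y where xy: "E r x" "E r y" "\<not> E b x" "\<not> E a y" "x \<noteq> b" "y \<noteq> a"
    and r: "\<not> E a r" "\<not> E b r" "r \<noteq> a" "r \<noteq> b"
    by (auto simp: guards_def)
  have "E a x" "E b y"
    using two_P2_free[OF \<open>E a b\<close>, of r x] two_P2_free[OF \<open>E a b\<close>, of r y] xy r by blast+
  moreover have "\<not> E y x"
    using house_free[of a b y x r] calculation xy r \<open>E a b\<close> sym by blast
  ultimately show thesis
    using that xy r \<open>E a b\<close> sym unfolding induced_C5_def by blast
qed

lemma exists_guards:
  assumes "E u v" and V: "\<And>x. x \<in> V \<Longrightarrow> \<exists>y. E x y"
  shows "\<exists>p q. (\<exists>x. E p x) \<and> (\<exists>x. E q x) \<and> (\<forall>r\<in>V. guards E p r \<or> guards E q r)"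
proof (cases "\<forall>r\<in>V. guards E u r \<or> guards E v r")
  case True
  then show ?thesis
    using \<open>E u v\<close> sym by blast
next
  case False
  then show ?thesis
    using unguarded_induced_C5[OF \<open>E u v\<close>] induced_C5_guards[OF _ V] by metis
qed

end

section \<open>Capture by a guard and a walker\<close>

lemma reachable_walk:
  assumes "wf_digraph G" "u \<rightarrow>\<^sup>*\<^bsub>G\<^esub> v"
  shows "\<exists>P n. P 0 = u \<and> (\<forall>t. game_step G (P t) (P (Suc t))) \<and> P n = v"
proof -
  interpret wf_digraph G by fact
  show ?thesis
    using assms(2)
  proof (induction rule: converse_reachable_induct)
    case base
    \<comment> \<open>Waiting at \<open>v\<close> forever makes the walk infinite, as plays are, so
      the walker always has a legal move.\<close>
    show ?case
      by (rule exI[of _ "\<lambda>_. v"]) (simp add: game_step_def)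
  next
    case (step x y)
    then obtain P n where P: "P 0 = y" "\<forall>t. game_step G (P t) (P (Suc t))" "P n = v"
      by blast
    have "game_step G (case_nat x P t) (case_nat x P (Suc t))" for t
      using P step.hyps by (cases t) (auto simp: game_step_def)
    then show ?case
      using P(3) by (intro exI[of _ "case_nat x P"] exI[of _ "Suc n"]) simp
  qed
qed

definition chase :: "('a, 'b) pre_digraph \<Rightarrow> 'a \<Rightarrow> 'a \<Rightarrow> 'a" where
  "chase G u r = (if game_step G u r then r else u)"

lemma game_step_chase: "game_step G u (chase G u r)"
  by (simp add: chase_def game_step_def)

text \<open>The cop \<open>g\<close> is the guard and \<open>w\<close> the cop who walks to the initial position of the robber.\<close>

lemma chase_walk_captures:
  assumes guard: "guards (dominates G) (g 0) (r 0)"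
    and r: "\<And>t. game_step G (r t) (r (Suc t))"
    and g: "\<And>t. g (Suc t) = chase G (g t) (r t)"
    and w: "w n = r 0"
  shows "\<exists>t. r t = g (Suc t) \<or> r t = w t"
proof (rule ccontr)
  assume "\<not> ?thesis"
  then have free: "\<And>t. r t \<noteq> g (Suc t)" "\<And>t. r t \<noteq> w t"
    by blast+
  \<comment> \<open>Without a capture neither piece moves: the guard cannot reach
    \<open>r 0\<close>, hence \<open>guard\<close> puts all neighbours of \<open>r 0\<close> within
    its reach, and leaving would be answered by a capture.\<close>
  have "r t = r 0 \<and> g t = g 0" for t
  proof (induction t)
    case (Suc t)
    have "\<not> game_step G (g 0) (r t)"
      using free(1)[of t] g[of t] Suc by (auto simp: chase_def)
    then have g': "g (Suc t) = g 0"
      using g[of t] Suc by (simp add: chase_def)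
    have "\<not> game_step G (g 0) (r (Suc t))"
      using free(1)[of "Suc t"] g[of "Suc t"] g' by (auto simp: chase_def)
    then show ?case
      using guard r[of t] g' Suc \<open>\<not> game_step G (g 0) (r t)\<close>
      by (auto simp: guards_def game_step_def)
  qed simp
  then show False
    using free(2) w by metis
qed

lemma cops_win_guards:
  assumes G: "wf_digraph G" and "p \<in> verts G" "q \<in> verts G"
    and reach: "\<And>u v. u \<in> verts G \<Longrightarrow> v \<in> verts G \<Longrightarrow> u \<rightarrow>\<^sup>*\<^bsub>G\<^esub> v"
    and guard: "\<And>r. r \<in> verts G \<Longrightarrow> guards (dominates G) p r \<or> guards (dominates G) q r"
  shows "cops_win G 2"
proof -
  have "\<exists>P. \<forall>u\<in>verts G. \<forall>v\<in>verts G. P u v 0 = u \<and>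
      (\<forall>t. game_step G (P u v t) (P u v (Suc t))) \<and> (\<exists>n. P u v n = v)"
    using reachable_walk[OF G reach] by metis
  then obtain P where P: "\<And>u v. u \<in> verts G \<Longrightarrow> v \<in> verts G \<Longrightarrow> P u v 0 = u"
      "\<And>u v t. u \<in> verts G \<Longrightarrow> v \<in> verts G \<Longrightarrow> game_step G (P u v t) (P u v (Suc t))"
      "\<And>u v. u \<in> verts G \<Longrightarrow> v \<in> verts G \<Longrightarrow> \<exists>n. P u v n = v"
    by metis
  \<comment> \<open>The first robber position \<open>hd rs\<close> fixes the roles for the whole
    play. The new position has index \<open>length cs\<close>, which is therefore the time at which
    the walk is read off.\<close>
  define s where "s cs rs = (if guards (dominates G) p (hd rs)
    then [chase G (last cs ! 0) (last rs), P q (hd rs) (length cs)]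
    else [P p (hd rs) (length cs), chase G (last cs ! 1) (last rs)])" for cs rs
  have "legal_cops G 2 c \<and> captured c r"
    if r: "legal_robber G r" and c: "follows_strategy [p, q] s c r" for c r
  proof -
    have r0: "r 0 \<in> verts G" and r_step: "\<And>t. game_step G (r t) (r (Suc t))"
      using r by (auto simp: legal_robber_def)
    have c0: "c 0 = [p, q]"
      using c by (simp add: follows_strategy_def)
    have hd: "hd (map r [0..<Suc t]) = r 0" for t
      by (simp add: hd_map del: upt_Suc)
    have c_Suc: "c (Suc t) = s (map c [0..<Suc t]) (map r [0..<Suc t])" for t
      using c by (simp add: follows_strategy_def)
    show ?thesis
    proof (cases "guards (dominates G) p (r 0)")
      case True
      \<comment> \<open>The recursive form of the guard's route that
        \<open>chase_walk_captures\<close> needs; \<open>c_eq\<close> identifies it with the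
        positions produced by the strategy.\<close>
      define g where "g = rec_nat p (\<lambda>t u. chase G u (r t))"
      have g: "g 0 = p" "\<And>t. g (Suc t) = chase G (g t) (r t)"
        by (simp_all add: g_def)
      have c_eq: "c t = [g t, P q (r 0) t]" for t
      proof (induction t)
        case 0
        then show ?case using c0 g P(1) assms r0 by simp
      next
        case (Suc t)
        then show ?case using c_Suc[of t] g True hd[of t] by (simp add: s_def)
      qed
      obtain n where n: "P q (r 0) n = r 0"
        using P(3) assms r0 by blast
      have "\<exists>t. r t = g (Suc t) \<or> r t = P q (r 0) t"
        using True r_step g n by (intro chase_walk_captures) auto
      then show ?thesis
        using assms P(2) r0 g P(1)
        by (auto simp: legal_cops_def captured_def c_eq game_step_chase c0)
    next
      case False
      define g where "g = rec_nat q (\<lambda>t u. chase G u (r t))"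
      have g: "g 0 = q" "\<And>t. g (Suc t) = chase G (g t) (r t)"
        by (simp_all add: g_def)
      have c_eq: "c t = [P p (r 0) t, g t]" for t
      proof (induction t)
        case 0
        then show ?case using c0 g P(1) assms r0 by simp
      next
        case (Suc t)
        then show ?case using c_Suc[of t] g False hd[of t] by (simp add: s_def)
      qed
      obtain n where n: "P p (r 0) n = r 0"
        using P(3) assms r0 by blast
      have "\<exists>t. r t = g (Suc t) \<or> r t = P p (r 0) t"
        using False guard[OF r0] r_step g n by (intro chase_walk_captures) auto
      then show ?thesis
        using assms P(2) r0 g P(1)
        by (auto simp: legal_cops_def captured_def c_eq game_step_chase c0)
    qed
  qed
  then show ?thesis
    unfolding cops_win_def by blast
qed

section \<open>From forbidden induced subgraphs to conditions on adjacency\<close>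

lemma contains_inducedI:
  assumes "graph G" "wf_digraph (with_proj H)"
    and inj: "inj_on f (pverts H)" and V: "f ` pverts H \<subseteq> verts G"
    and adj: "\<And>i j. i \<in> pverts H \<Longrightarrow> j \<in> pverts H \<Longrightarrow> (i, j) \<in> parcs H \<longleftrightarrow> f i \<rightarrow>\<^bsub>G\<^esub> f j"
  shows "contains_induced G H"
proof -
  interpret graph G by fact
  interpret H: wf_digraph "with_proj H" by fact
  \<comment> \<open>Arcs of \<open>G\<close> are arbitrary objects, so an isomorphism must also map
    arcs. Without parallel arcs, the ends determine the image.\<close>
  define g where "g = (\<lambda>(i, j). THE e. e \<in> arcs G \<and> tail G e = f i \<and> head G e = f j)"
  have in_H: "i \<in> pverts H" "j \<in> pverts H" if "(i, j) \<in> parcs H" for i j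
    using H.wellformed that by force+
  have unique: "g (i, j) = e"
    if "e \<in> arcs G" "tail G e = f i" "head G e = f j" for i j e
    unfolding g_def using that no_multi_arcs
    by (auto simp: arc_to_ends_def intro!: the_equality)
  have g: "g (i, j) \<in> arcs G \<and> tail G (g (i, j)) = f i \<and> head G (g (i, j)) = f j"
    if "(i, j) \<in> parcs H" for i j
  proof -
    have "f i \<rightarrow>\<^bsub>G\<^esub> f j"
      using adj in_H that by blast
    then obtain e where "e \<in> arcs G" "tail G e = f i" "head G e = f j"
      by (auto simp: arcs_ends_def arc_to_ends_def)
    then show ?thesis
      using unique by simp
  qed
  \<comment> \<open>Keeping \<open>head G\<close> and \<open>tail G\<close> makes the image of
    \<open>H\<close> equal to an induced subgraph of \<open>G\<close>, not just isomorphic to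
    one.\<close>
  define h where "h = \<lparr>iso_verts = f, iso_arcs = g, iso_head = head G, iso_tail = tail G\<rparr>"
  have "inj_on g (parcs H)"
  proof (rule inj_onI)
    fix x y assume xy: "x \<in> parcs H" "y \<in> parcs H" "g x = g y"
    obtain i j k l where eq: "x = (i, j)" "y = (k, l)"
      by fastforce
    have "f i = f k" "f j = f l"
      using g[of i j] g[of k l] xy eq by auto
    then show "x = y"
      using inj in_H xy eq by (auto dest: inj_onD)
  qed
  then have "pre_digraph.digraph_isomorphism (with_proj H) h"
    using g inj H.wf_digraph unfolding pre_digraph.digraph_isomorphism_def h_def
    by auto
  moreover have "G \<restriction> (f ` pverts H) = app_iso h (with_proj H)"
  proof -
    have "{e \<in> arcs G. tail G e \<in> f ` pverts H \<and> head G e \<in> f ` pverts H} = g ` parcs H"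
    proof (intro set_eqI iffI)
      fix e assume "e \<in> {e \<in> arcs G. tail G e \<in> f ` pverts H \<and> head G e \<in> f ` pverts H}"
      then obtain i j where e: "e \<in> arcs G" "i \<in> pverts H" "tail G e = f i"
          "j \<in> pverts H" "head G e = f j"
        by blast
      then have "(i, j) \<in> parcs H"
        using adj by (metis in_arcs_imp_in_arcs_ends)
      then show "e \<in> g ` parcs H"
        using unique e by force
    next
      fix e assume "e \<in> g ` parcs H"
      then show "e \<in> {e \<in> arcs G. tail G e \<in> f ` pverts H \<and> head G e \<in> f ` pverts H}"
        using g in_H by auto
    qed
    then show ?thesis
      by (simp add: app_iso_def h_def induce_subgraph_def)
  qed
  ultimately show ?thesis
    unfolding contains_induced_def digraph_iso_def using induced_induce[OF V] by blast
qed

text \<open>A counterexample to a locale assumption, listed in a suitable order, embeds the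
  forbidden graph.\<close>

lemma two_P2_house_freeI:
  assumes "graph G" and P2: "\<not> contains_induced G two_P2" and house: "\<not> contains_induced G house"
  shows "two_P2_house_free (dominates G)"
proof -
  interpret graph G by fact
  have sym: "u \<rightarrow>\<^bsub>G\<^esub> v \<Longrightarrow> v \<rightarrow>\<^bsub>G\<^esub> u" for u v
    using sym_arcs by (auto simp: symmetric_def dest: symD)
  have irrefl: "\<not> v \<rightarrow>\<^bsub>G\<^esub> v" for v
    using adj_not_same by blast
  show ?thesis
  proof
    fix w x y z assume E: "w \<rightarrow>\<^bsub>G\<^esub> x" "y \<rightarrow>\<^bsub>G\<^esub> z"
    show "w \<rightarrow>\<^bsub>G\<^esub> y \<or> w \<rightarrow>\<^bsub>G\<^esub> z \<or> x \<rightarrow>\<^bsub>G\<^esub> y \<or> x \<rightarrow>\<^bsub>G\<^esub> z"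
    proof (rule ccontr)
      assume N: "\<not> ?thesis"
      let ?f = "case_sum (\<lambda>i. [w, x] ! i) (\<lambda>i. [y, z] ! i)"
      have V: "pverts two_P2 = {Inl 0, Inl 1, Inr 0, Inr 1}"
        by (auto simp: two_P2_def disjoint_union_graph_def path_graph_def)
      have A: "parcs two_P2 = {(Inl 0, Inl 1), (Inl 1, Inl 0), (Inr 0, Inr 1), (Inr 1, Inr 0)}"
        by (force simp: two_P2_def disjoint_union_graph_def path_graph_def less_2_cases_iff)
      have "contains_induced G two_P2"
      proof (rule contains_inducedI[where f = ?f])
        show "wf_digraph (with_proj two_P2)"
          by unfold_locales (auto simp: V A)
        show "inj_on ?f (pverts two_P2)"
          using E N sym irrefl by (auto simp: V inj_on_def)
        show "?f ` pverts two_P2 \<subseteq> verts G"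
          using E by (auto simp: V adj_in_verts)
        show "(i, j) \<in> parcs two_P2 \<longleftrightarrow> ?f i \<rightarrow>\<^bsub>G\<^esub> ?f j"
          if "i \<in> pverts two_P2" "j \<in> pverts two_P2" for i j
          using that E N sym irrefl unfolding V A by auto
      qed fact
      then show False
        using P2 by blast
    qed
  next
    fix a b y x r
    assume E: "a \<rightarrow>\<^bsub>G\<^esub> b" "b \<rightarrow>\<^bsub>G\<^esub> y" "y \<rightarrow>\<^bsub>G\<^esub> x" "x \<rightarrow>\<^bsub>G\<^esub> a" "r \<rightarrow>\<^bsub>G\<^esub> x" "r \<rightarrow>\<^bsub>G\<^esub> y"
    show "a \<rightarrow>\<^bsub>G\<^esub> y \<or> b \<rightarrow>\<^bsub>G\<^esub> x \<or> r \<rightarrow>\<^bsub>G\<^esub> a \<or> r \<rightarrow>\<^bsub>G\<^esub> b"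
    proof (rule ccontr)
      assume N: "\<not> ?thesis"
      \<comment> \<open>The nonadjacent pairs form the path \<open>y - a - r - b - x\<close>.\<close>
      let ?f = "\<lambda>i. [y, a, r, b, x] ! i"
      have V: "pverts house = {0, 1, 2, 3, 4}"
        by (auto simp: house_def complement_graph_def path_graph_def)
      have A: "parcs house = {(i, j). i < 5 \<and> j < 5 \<and> i \<noteq> j \<and> j \<noteq> Suc i \<and> i \<noteq> Suc j}"
        by (auto simp: house_def complement_graph_def path_graph_def)
      have N': "\<not> a \<rightarrow>\<^bsub>G\<^esub> y" "\<not> y \<rightarrow>\<^bsub>G\<^esub> a" "\<not> b \<rightarrow>\<^bsub>G\<^esub> x" "\<not> x \<rightarrow>\<^bsub>G\<^esub> b"
          "\<not> r \<rightarrow>\<^bsub>G\<^esub> a" "\<not> a \<rightarrow>\<^bsub>G\<^esub> r" "\<not> r \<rightarrow>\<^bsub>G\<^esub> b" "\<not> b \<rightarrow>\<^bsub>G\<^esub> r"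
        using N sym by blast+
      have "contains_induced G house"
      proof (rule contains_inducedI[where f = ?f])
        show "wf_digraph (with_proj house)"
          by unfold_locales (auto simp: house_def complement_graph_def)
        have "distinct [y, a, r, b, x]"
          using E N' irrefl by auto
        then show "inj_on ?f (pverts house)"
          by (auto simp: V inj_on_def)
        show "?f ` pverts house \<subseteq> verts G"
          using E by (auto simp: V adj_in_verts)
        show "(i, j) \<in> parcs house \<longleftrightarrow> ?f i \<rightarrow>\<^bsub>G\<^esub> ?f j"
          if "i \<in> pverts house" "j \<in> pverts house" for i j
          using that E E[THEN sym] N' irrefl unfolding V A
          by (elim insertE emptyE) simp_all
      qed fact
      then show False
        using house by blast
    qed
  qed (use sym irrefl in blast)+
qed

theorem theorem5:
  fixes G :: "('a, 'b) pre_digraph"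
  assumes "graph G"
    and "connected G"
    and "\<not> contains_induced G two_P2"
    and "\<not> contains_induced G house"
  shows "cop_number G \<le> 2"
proof -
  interpret graph G by fact
  interpret two_P2_house_free "dominates G"
    using assms by (intro two_P2_house_freeI)
  have reach: "u \<rightarrow>\<^sup>*\<^bsub>G\<^esub> v" if "u \<in> verts G" "v \<in> verts G" for u v
    using symmetric_connected_imp_strongly_connected[OF sym_arcs assms(2)] that by blast
  have "\<exists>p\<in>verts G. \<exists>q\<in>verts G. \<forall>r\<in>verts G.
    guards (dominates G) p r \<or> guards (dominates G) q r"
  proof (cases "\<forall>x\<in>verts G. \<exists>y. x \<rightarrow>\<^bsub>G\<^esub> y")
    case True
    moreover obtain u where "u \<in> verts G"
      using assms(2) by (auto simp: connected_def strongly_connected_def)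
    ultimately obtain v where "u \<rightarrow>\<^bsub>G\<^esub> v"
      by blast
    from exists_guards[OF this, of "verts G"] True show ?thesis
      by (meson adj_in_verts(1))
  next
    case False
    then obtain x where x: "x \<in> verts G" "\<And>y. \<not> x \<rightarrow>\<^bsub>G\<^esub> y"
      by blast
    \<comment> \<open>Connectedness makes an isolated vertex the only one, and it guards
      itself.\<close>
    have "r = x" if "r \<in> verts G" for r
      using reach[OF x(1) that] x(2) by (auto elim: converse_reachable_cases)
    then show ?thesis
      using x(1) by (auto simp: guards_def)
  qed
  then have "cops_win G 2"
    using cops_win_guards[OF wf_digraph _ _ reach] by blast
  then show ?thesis
    unfolding cop_number_def by (rule Least_le)
qed

end
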